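(* Fix $h\in\mathbb C^\times$, let $U\subseteq\mathbb C$ be half-step-invariant, and let $X:U\to\mathbb C$ be an admissible map. Then there exist constants $A,B\in\mathbb C$ (global, that is, independent of any choice of base point $s_0\in U$) such that $$Y_1+Z_1=A\,X+B$$ throughout $U$. In particular, on every full-step arithmetic progression $s_0+h\mathbb Z\subseteq U$ the values of $X$ satisfy a second-order linear recurrence with constant coefficients and are determined along that progression by the pair $X(s_0)$, $Y_1(s_0)$. Moreover, exactly one of the following cases holds. (i) $A=2$. For every $s_0\in U$ and every $k\in\mathbb Z$, $$X(s_0+kh)=a\,k^2+b_{s_0}\,k+c_{s_0},\qquad a=\frac B2,\quad b_{s_0}=Y_1(s_0)-X(s_0)-\frac B2,\quad c_{s_0}=X(s_0).$$ (ii) $A=-2$. In this case admissibility forces the additional first-order relation $$Y_1+X=\frac B2$$ throughout $U$, and consequently, for every $s_0\in U$ and every $k\in\mathbb Z$, $$X(s_0+kh)=(-1)^k a_{s_0}+b,\qquad a_{s_0}=X(s_0)-\frac B4,\quad b=\frac B4.$$ (iii) $A^2\neq4$. Fix $q\in\mathbb C^\times$ with $q\neq\pm1$ such that $A=q+q^{-1}$, and set $c=\dfrac{B}{2-A}$. Then, for every $s_0\in U$ and every $k\in\mathbb Z$, $$X(s_0+kh)=a_{s_0}q^k+b_{s_0}q^{-k}+c,$$ where $$a_{s_0}=\frac{Y_1(s_0)-c-(X(s_0)-c)q^{-1}}{q-q^{-1}},\qquad b_{s_0}=\frac{(X(s_0)-c)q-Y_1(s_0)+c}{q-q^{-1}}.$$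 In particular, along each full-step arithmetic progression $s_0+h\mathbb Z\subseteq U$ the map $X$ is necessarily of quadratic type (i), alternating type (ii), or $q$-exponential type (iii), and no other dependence is compatible with admissibility. The coefficients not fixed globally by $A$ and $B$ are determined by the initial values along the chosen progression and may vary from one progression to another.
   Context: $\mathbb C^\times=\mathbb C\setminus\{0\}$. Fix $h\in\mathbb C^\times$. A non-empty set $U\subseteq\mathbb C$ is half-step-invariant (relative to $h$) if $U\pm\frac h2\subseteq U$. For a map $X:U\to\mathbb C$ and $s\in U$ put $$Y(s)=X(s+\tfrac h2),\quad Z(s)=X(s-\tfrac h2),\quad Y_1(s)=X(s+h),\quad Z_1(s)=X(s-h).$$ Identities among $X,Y,Z,Y_1,Z_1$ "throughout $U$" are pointwise identities for every $s\in U$. The map $X$ is a parametrising map on $U$ if $Y-Z$ vanishes nowhere on $U$. A parametrising map $X$ is admissible on $U$ if $X(U)$ is infinite and, for every complex polynomial $p$ of degree at least $1$, there exists a polynomial $Q$ of degree at most $\deg p-1$ such that $$\frac{p(Y)-p(Z)}{Y-Z}=Q(X)$$ throughout $U$. *)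

theory Defs
  imports Complex_Main "HOL-Computational_Algebra.Polynomial"
begin

text \<open>
  A map \<open>X : U \<rightarrow> \<complex>\<close> is a total function of which only the values on \<open>U\<close> matter: all
  shifts below stay inside a half-step-invariant \<open>U\<close>.  The shifted maps are written out:
  \<open>Y s = X (s + h / 2)\<close>, \<open>Z s = X (s - h / 2)\<close>, \<open>Y\<^sub>1 s = X (s + h)\<close>, \<open>Z\<^sub>1 s = X (s - h)\<close>.
\<close>

definition half_step_invariant :: "complex \<Rightarrow> complex set \<Rightarrow> bool" where
  "half_step_invariant h U \<longleftrightarrow> U \<noteq> {} \<and> (\<forall>s\<in>U. s + h / 2 \<in> U \<and> s - h / 2 \<in> U)"

definition parametrising_map :: "complex \<Rightarrow> complex set \<Rightarrow> (complex \<Rightarrow> complex) \<Rightarrow> bool" where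
  "parametrising_map h U X \<longleftrightarrow> (\<forall>s\<in>U. X (s + h / 2) - X (s - h / 2) \<noteq> 0)"

definition admissible :: "complex \<Rightarrow> complex set \<Rightarrow> (complex \<Rightarrow> complex) \<Rightarrow> bool" where
  "admissible h U X \<longleftrightarrow>
     parametrising_map h U X \<and> infinite (X ` U) \<and>
     (\<forall>p :: complex poly. degree p \<ge> 1 \<longrightarrow>
        (\<exists>Q :: complex poly. degree Q \<le> degree p - 1 \<and>
           (\<forall>s\<in>U. (poly p (X (s + h / 2)) - poly p (X (s - h / 2))) /
                    (X (s + h / 2) - X (s - h / 2)) = poly Q (X s))))"

definition three_term_relation ::
    "complex \<Rightarrow> complex set \<Rightarrow> (complex \<Rightarrow> complex) \<Rightarrow> complex \<Rightarrow> complex \<Rightarrow> bool" where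
  "three_term_relation h U X A B \<longleftrightarrow> (\<forall>s\<in>U. X (s + h) + X (s - h) = A * X s + B)"

definition progression :: "complex \<Rightarrow> complex \<Rightarrow> complex set" where
  "progression h s\<^sub>0 = {s\<^sub>0 + of_int k * h | k. True}"

definition along :: "complex \<Rightarrow> (complex \<Rightarrow> complex) \<Rightarrow> complex \<Rightarrow> int \<Rightarrow> complex" where
  "along h X s\<^sub>0 k = X (s\<^sub>0 + of_int k * h)"

definition second_order_recurrence :: "complex \<Rightarrow> complex \<Rightarrow> (int \<Rightarrow> complex) \<Rightarrow> bool" where
  "second_order_recurrence A B x \<longleftrightarrow> (\<forall>k. x (k + 2) = A * x (k + 1) - x k + B)"


definition quad_b :: "complex \<Rightarrow> (complex \<Rightarrow> complex) \<Rightarrow> complex \<Rightarrow> complex \<Rightarrow> complex" where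
  "quad_b h X B s\<^sub>0 = X (s\<^sub>0 + h) - X s\<^sub>0 - B / 2"

definition quad_c :: "(complex \<Rightarrow> complex) \<Rightarrow> complex \<Rightarrow> complex" where
  "quad_c X s\<^sub>0 = X s\<^sub>0"

definition alt_a :: "(complex \<Rightarrow> complex) \<Rightarrow> complex \<Rightarrow> complex \<Rightarrow> complex" where
  "alt_a X B s\<^sub>0 = X s\<^sub>0 - B / 4"

definition qexp_a ::
    "complex \<Rightarrow> (complex \<Rightarrow> complex) \<Rightarrow> complex \<Rightarrow> complex \<Rightarrow> complex \<Rightarrow> complex" where
  "qexp_a h X q c s\<^sub>0 = (X (s\<^sub>0 + h) - c - (X s\<^sub>0 - c) * inverse q) / (q - inverse q)"

definition qexp_b ::
    "complex \<Rightarrow> (complex \<Rightarrow> complex) \<Rightarrow> complex \<Rightarrow> complex \<Rightarrow> complex \<Rightarrow> complex" where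
  "qexp_b h X q c s\<^sub>0 = ((X s\<^sub>0 - c) * q - X (s\<^sub>0 + h) + c) / (q - inverse q)"


definition quadratic_case ::
    "complex \<Rightarrow> complex set \<Rightarrow> (complex \<Rightarrow> complex) \<Rightarrow> complex \<Rightarrow> complex \<Rightarrow> bool" where
  "quadratic_case h U X A B \<longleftrightarrow> A = 2 \<and>
     (\<forall>s\<^sub>0\<in>U. \<forall>k. X (s\<^sub>0 + of_int k * h) =
        (B / 2) * of_int k ^ 2 + quad_b h X B s\<^sub>0 * of_int k + quad_c X s\<^sub>0)"

definition alternating_case ::
    "complex \<Rightarrow> complex set \<Rightarrow> (complex \<Rightarrow> complex) \<Rightarrow> complex \<Rightarrow> complex \<Rightarrow> bool" where
  "alternating_case h U X A B \<longleftrightarrow> A = -2 \<and>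
     (\<forall>s\<in>U. X (s + h) + X s = B / 2) \<and>
     (\<forall>s\<^sub>0\<in>U. \<forall>k. X (s\<^sub>0 + of_int k * h) = (-1) powi k * alt_a X B s\<^sub>0 + B / 4)"

text \<open>
  ``Fix \<open>q\<close>'' is read as: such a \<open>q\<close> exists, and the formula holds for every such \<open>q\<close>.
\<close>

definition q_parameter :: "complex \<Rightarrow> complex \<Rightarrow> bool" where
  "q_parameter A q \<longleftrightarrow> q \<noteq> 0 \<and> q \<noteq> 1 \<and> q \<noteq> -1 \<and> A = q + inverse q"

definition q_exponential_case ::
    "complex \<Rightarrow> complex set \<Rightarrow> (complex \<Rightarrow> complex) \<Rightarrow> complex \<Rightarrow> complex \<Rightarrow> bool" where
  "q_exponential_case h U X A B \<longleftrightarrow> A ^ 2 \<noteq> 4 \<and>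
     (\<exists>q. q_parameter A q) \<and>
     (\<forall>q c. q_parameter A q \<longrightarrow> c = B / (2 - A) \<longrightarrow>
        (\<forall>s\<^sub>0\<in>U. \<forall>k. X (s\<^sub>0 + of_int k * h) =
           qexp_a h X q c s\<^sub>0 * q powi k + qexp_b h X q c s\<^sub>0 * q powi (- k) + c))"


definition quadratic_type :: "(int \<Rightarrow> complex) \<Rightarrow> bool" where
  "quadratic_type x \<longleftrightarrow> (\<exists>a b c. \<forall>k. x k = a * of_int k ^ 2 + b * of_int k + c)"

definition alternating_type :: "(int \<Rightarrow> complex) \<Rightarrow> bool" where
  "alternating_type x \<longleftrightarrow> (\<exists>a b. \<forall>k. x k = (-1) powi k * a + b)"

definition q_exponential_type :: "(int \<Rightarrow> complex) \<Rightarrow> bool" where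
  "q_exponential_type x \<longleftrightarrow>
     (\<exists>q a b c. q \<noteq> 0 \<and> q \<noteq> 1 \<and> q \<noteq> -1 \<and> (\<forall>k. x k = a * q powi k + b * q powi (- k) + c))"


definition varies_between_progressions ::
    "complex \<Rightarrow> complex set \<Rightarrow> (complex \<Rightarrow> complex) \<Rightarrow> bool" where
  "varies_between_progressions h U f \<longleftrightarrow>
     (\<exists>s\<in>U. \<exists>t\<in>U. progression h s \<inter> progression h t = {} \<and> f s \<noteq> f t)"

text \<open>
  ``May vary'': for each of the three types there is an admissible map of that type all of
  whose base-point-dependent coefficients take different values on different progressions.
\<close>

definition coefficients_may_vary :: "complex \<Rightarrow> bool" where
  "coefficients_may_vary h \<longleftrightarrow>
     (\<exists>V W B. half_step_invariant h V \<and> admissible h V W \<and> three_term_relation h V W 2 B \<and>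
        varies_between_progressions h V (quad_b h W B) \<and>
        varies_between_progressions h V (quad_c W)) \<and>
     (\<exists>V W B. half_step_invariant h V \<and> admissible h V W \<and> three_term_relation h V W (-2) B \<and>
        varies_between_progressions h V (alt_a W B)) \<and>
     (\<exists>V W A B q. half_step_invariant h V \<and> admissible h V W \<and> three_term_relation h V W A B \<and>
        A ^ 2 \<noteq> 4 \<and> q_parameter A q \<and>
        varies_between_progressions h V (qexp_a h W q (B / (2 - A))) \<and>
        varies_between_progressions h V (qexp_b h W q (B / (2 - A))))"

end

theory Submission
  imports Defs
begin

text \<open>
  Admissibility for \<open>p = x\<^sup>2\<close> alone says that \<open>Y + Z = \<alpha> X + \<beta>\<close>; iterating this half-step relation
  gives the full-step one with \<open>A = \<alpha>\<^sup>2 - 2\<close> and \<open>B = (\<alpha> + 2) \<beta>\<close>.  If \<open>A = -2\<close> then \<open>\<alpha> = 0\<close>, so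
  \<open>Y + Z\<close> is constant, which is the extra first-order relation.

  For the variation of the coefficients, the maps \<open>s\<close> and \<open>exp (l s)\<close> are admissible (of
  alternating type for \<open>l = \<i> \<pi> / h\<close>), and since \<open>(p(Y) - p(Z)) / (Y - Z)\<close> is symmetric in \<open>Y\<close>
  and \<open>Z\<close>, one may replace \<open>s\<close> by \<open>-s\<close> on some of the cosets of \<open>(h/2)\<int>\<close> without changing \<open>Q\<close>.
\<close>

section \<open>Second-order recurrences on the integers\<close>

text \<open>Induction runs in both directions on a pair of consecutive values: \<open>x k\<close>
  enters the recurrence with coefficient -1, so it can also be solved backwards.\<close>

lemma second_order_recurrence_unique:
  assumes "second_order_recurrence A B x" "second_order_recurrence A B y"
    and "x 0 = y 0" "x 1 = y 1"
  shows "x = y"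
proof
  fix k
  have rec: "x (i + 2) = A * x (i + 1) - x i + B" "y (i + 2) = A * y (i + 1) - y i + B" for i
    using assms(1,2) by (auto simp: second_order_recurrence_def)
  have "x k = y k \<and> x (k + 1) = y (k + 1)"
  proof (induction k rule: int_induct[where k = 0])
    case base
    then show ?case using assms(3,4) by simp
  next
    case (step1 i)
    then show ?case using rec[of i] by (simp add: add.assoc)
  next
    case (step2 i)
    then show ?case using rec[of "i - 1"] by (simp add: add.commute)
  qed
  then show "x k = y k" ..
qed

lemma second_order_recurrence_quadratic:
  "second_order_recurrence 2 B (\<lambda>k. (B / 2) * of_int k ^ 2 + b * of_int k + c)"
  by (simp add: second_order_recurrence_def power2_eq_square field_simps)

lemma second_order_recurrence_alternating:
  "second_order_recurrence (-2) B (\<lambda>k. (-1) powi k * a + B / 4)"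
  by (simp add: second_order_recurrence_def power_int_add field_simps)

text \<open>\<open>q\<close> and \<open>inverse q\<close> are the roots of t^2 - A t + 1 with A =
  \<open>q + inverse q\<close>, and \<open>c\<close> is the constant solution; its defining equation
  is kept free of division.\<close>

lemma second_order_recurrence_q_exponential:
  fixes q :: complex
  assumes "q \<noteq> 0" and "c * (2 - (q + inverse q)) = B"
  shows "second_order_recurrence (q + inverse q) B (\<lambda>k. a * q powi k + b * q powi (- k) + c)"
  unfolding second_order_recurrence_def assms(2)[symmetric]
proof
  fix k :: int
  have "q powi (k + 2) = q powi k * q ^ 2" "q powi (k + 1) = q powi k * q"
    using assms(1) by (simp_all add: power_int_add)
  moreover have "q powi (- (k + 2)) = q powi (- k) * inverse q ^ 2"
      "q powi (- (k + 1)) = q powi (- k) * inverse q"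
    using assms(1) by (simp_all add: power_int_add power_int_diff power_int_minus divide_inverse
      power_inverse)
  moreover have "q * inverse q = 1"
    using assms(1) by simp
  ultimately show "a * q powi (k + 2) + b * q powi (- (k + 2)) + c =
      (q + inverse q) * (a * q powi (k + 1) + b * q powi (- (k + 1)) + c) -
      (a * q powi k + b * q powi (- k) + c) + c * (2 - (q + inverse q))"
    by algebra
qed

section \<open>Consequences of admissibility\<close>

lemma two_half_steps:
  fixes s h :: complex
  shows "s + h / 2 + h / 2 = s + h" "s - h / 2 - h / 2 = s - h"
  by (simp_all add: field_simps)

lemma half_step_invariant_shift:
  assumes "half_step_invariant h U" "s \<in> U"
  shows "s + of_int k * h \<in> U"
proof (induction k rule: int_induct[where k = 0])
  case base
  then show ?case using assms(2) by simp
next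
  case (step1 i)
  then have "s + of_int i * h + h / 2 + h / 2 \<in> U"
    using assms(1) unfolding half_step_invariant_def by blast
  then show ?case by (simp add: two_half_steps algebra_simps)
next
  case (step2 i)
  then have "s + of_int i * h - h / 2 - h / 2 \<in> U"
    using assms(1) unfolding half_step_invariant_def by blast
  then show ?case by (simp add: two_half_steps algebra_simps)
qed

lemma admissible_half_step_relation:
  assumes "admissible h U X"
  obtains \<alpha> \<beta> where "\<And>s. s \<in> U \<Longrightarrow> X (s + h / 2) + X (s - h / 2) = \<alpha> * X s + \<beta>"
proof -
  have "degree (monom (1::complex) 2) = 2"
    by (simp add: degree_monom_eq)
  then obtain Q :: "complex poly" where Q: "degree Q \<le> 1"
    "\<And>s. s \<in> U \<Longrightarrow> (poly (monom 1 2) (X (s + h / 2)) - poly (monom 1 2) (X (s - h / 2))) /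
        (X (s + h / 2) - X (s - h / 2)) = poly Q (X s)"
    using assms unfolding admissible_def
    by (metis diff_add_inverse one_add_one one_le_numeral)
  \<comment> \<open>\<open>Q\<close> may be constant, so \<alpha> = 0 is allowed; this is the source
    of the alternating case.\<close>
  obtain \<alpha> \<beta> where "Q = [:\<beta>, \<alpha>:]"
    using degree_eq_zeroE Q(1) by (metis degree1_coeffs le_antisym less_one not_le pCons_0_0)
  moreover have "X (s + h / 2) + X (s - h / 2) = poly Q (X s)" if "s \<in> U" for s
  proof -
    \<comment> \<open>The parametrising condition permits cancelling Y - Z, which leaves Y +
      Z.\<close>
    have "X (s + h / 2) - X (s - h / 2) \<noteq> 0"
      using assms that unfolding admissible_def parametrising_map_def by blast
    moreover have "(X (s + h / 2))\<^sup>2 - (X (s - h / 2))\<^sup>2 =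
        (X (s + h / 2) + X (s - h / 2)) * (X (s + h / 2) - X (s - h / 2))"
      by algebra
    ultimately show ?thesis
      using Q(2)[OF that] by (simp add: poly_monom)
  qed
  ultimately show thesis
    using that[of \<alpha> \<beta>] by (simp add: algebra_simps)
qed

text \<open>Adding the half-step relations centred at \<open>s + h / 2\<close> and
  \<open>s - h / 2\<close> gives Y1 + 2 X + Z1 = \<alpha> (Y + Z) + 2 \<beta>; the relation at
  \<open>s\<close> then eliminates Y + Z.\<close>

lemma three_term_relation_if_half_step_relation:
  assumes "half_step_invariant h U"
    and half: "\<And>s. s \<in> U \<Longrightarrow> X (s + h / 2) + X (s - h / 2) = \<alpha> * X s + \<beta>"
  shows "three_term_relation h U X (\<alpha>\<^sup>2 - 2) ((\<alpha> + 2) * \<beta>)"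
  unfolding three_term_relation_def
proof
  fix s assume s: "s \<in> U"
  then have "s + h / 2 \<in> U" "s - h / 2 \<in> U"
    using assms(1) by (auto simp: half_step_invariant_def)
  then have "X (s + h) + X s = \<alpha> * X (s + h / 2) + \<beta>" "X s + X (s - h) = \<alpha> * X (s - h / 2) + \<beta>"
    using half[of "s + h / 2"] half[of "s - h / 2"] by (simp_all add: two_half_steps)
  with half[OF s] show "X (s + h) + X (s - h) = (\<alpha>\<^sup>2 - 2) * X s + (\<alpha> + 2) * \<beta>"
    by algebra
qed

lemma three_term_relation_along:
  assumes "half_step_invariant h U" "three_term_relation h U X A B" "s \<in> U"
  shows "second_order_recurrence A B (along h X s)"
  unfolding second_order_recurrence_def
proof
  fix k
  \<comment> \<open>The relation is centred at index \<open>k + 1\<close>, so that its neighbours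
    have indices \<open>k\<close> and \<open>k + 2\<close>.\<close>
  have "s + of_int (k + 1) * h \<in> U"
    using half_step_invariant_shift assms(1,3) .
  then have "X (s + of_int (k + 1) * h + h) + X (s + of_int (k + 1) * h - h) =
      A * X (s + of_int (k + 1) * h) + B"
    using assms(2) unfolding three_term_relation_def by blast
  then show "along h X s (k + 2) = A * along h X s (k + 1) - along h X s k + B"
    by (simp add: along_def algebra_simps)
qed

text \<open>By uniqueness, every closed form below reduces to the recurrence and agreement at the
  indices 0 and 1.\<close>

lemma three_term_relation_closed_form:
  assumes "half_step_invariant h U" "three_term_relation h U X A B" "s \<in> U"
    and "second_order_recurrence A B x" "x 0 = X s" "x 1 = X (s + h)"
  shows "X (s + of_int k * h) = x k"
proof -
  have "x = along h X s"
    using assms(4) three_term_relation_along[OF assms(1-3)]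
    by (rule second_order_recurrence_unique) (simp_all add: along_def assms(5,6))
  then show ?thesis by (simp add: along_def)
qed

section \<open>Closed forms in the three cases\<close>

lemma quadratic_caseI:
  assumes "half_step_invariant h U" "three_term_relation h U X 2 B"
  shows "quadratic_case h U X 2 B"
  unfolding quadratic_case_def
proof (intro conjI ballI allI refl)
  fix s k assume "s \<in> U"
  from three_term_relation_closed_form[OF assms this second_order_recurrence_quadratic]
  show "X (s + of_int k * h) =
      (B / 2) * of_int k ^ 2 + quad_b h X B s * of_int k + quad_c X s"
    by (simp add: quad_b_def quad_c_def)
qed

text \<open>For A = -2 the characteristic root -1 is double, so the general solution is (-1)^k (a +
  b k) + B/4. The first-order relation fixes the value at index 1 so that b = 0.\<close>

lemma alternating_caseI:
  assumes "half_step_invariant h U" "three_term_relation h U X (-2) B"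
    and first_order: "\<forall>s\<in>U. X (s + h) + X s = B / 2"
  shows "alternating_case h U X (-2) B"
  unfolding alternating_case_def
proof (intro conjI ballI allI refl)
  fix s k assume s: "s \<in> U"
  have "X (s + h) = B / 2 - X s"
    using first_order s by (simp add: eq_diff_eq)
  with three_term_relation_closed_form[OF assms(1,2) s second_order_recurrence_alternating]
  show "X (s + of_int k * h) = (-1) powi k * alt_a X B s + B / 4"
    by (simp add: alt_a_def)
qed (use first_order in blast)

lemma ex_q_parameter:
  assumes "A\<^sup>2 \<noteq> 4"
  shows "\<exists>q. q_parameter A q"
proof -
  \<comment> \<open>A root of t^2 - A t + 1 by the quadratic formula; a root 1 or -1 would force A =
    2 or A = -2.\<close>
  define q where "q = (A + csqrt (A\<^sup>2 - 4)) / 2"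
  have "2 * q - A = csqrt (A\<^sup>2 - 4)"
    by (simp add: q_def field_simps)
  then have "(2 * q - A)\<^sup>2 = A\<^sup>2 - 4"
    by simp
  then have "4 * (q * (A - q) - 1) = 0"
    by algebra
  then have q: "q * (A - q) = 1"
    by simp
  then have "q \<noteq> 0" by auto
  moreover have "inverse q = A - q"
    using q by (rule inverse_unique)
  moreover have "q \<noteq> 1" "q \<noteq> -1"
    using q assms by (algebra, algebra)
  ultimately show ?thesis
    by (auto simp: q_parameter_def)
qed

lemma q_exponential_caseI:
  assumes "half_step_invariant h U" "three_term_relation h U X A B" "A\<^sup>2 \<noteq> 4"
  shows "q_exponential_case h U X A B"
  unfolding q_exponential_case_def
proof (intro conjI allI impI ballI)
  fix q c s k
  assume q: "q_parameter A q" and c: "c = B / (2 - A)" and s: "s \<in> U"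
  have A: "A = q + inverse q" and q0: "q \<noteq> 0" and "q \<noteq> 1" "q \<noteq> -1"
    using q by (auto simp: q_parameter_def)
  have "q - inverse q \<noteq> 0"
  proof
    assume "q - inverse q = 0"
    then have "q\<^sup>2 = 1"
      using q0 by (simp add: field_simps power2_eq_square)
    then show False
      using \<open>q \<noteq> 1\<close> \<open>q \<noteq> -1\<close> by (simp add: power2_eq_1_iff)
  qed
  then have ab: "qexp_a h X q c s * (q - inverse q) = X (s + h) - c - (X s - c) * inverse q"
      "qexp_b h X q c s * (q - inverse q) = (X s - c) * q - X (s + h) + c"
    by (simp_all add: qexp_a_def qexp_b_def)
  have qi: "q * inverse q = 1"
    using q0 by simp
  \<comment> \<open>This makes \<open>c = B / (2 - A)\<close> a genuine constant solution rather
    than a division by zero.\<close>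
  have "A \<noteq> 2"
    using assms(3) by auto
  then have "c * (2 - (q + inverse q)) = B"
    by (simp add: c A)
  then have rec: "second_order_recurrence A B
      (\<lambda>k. qexp_a h X q c s * q powi k + qexp_b h X q c s * q powi (- k) + c)"
    unfolding A by (rule second_order_recurrence_q_exponential[OF q0])
  \<comment> \<open>The initial conditions at 0 and 1 are multiplied by the nonzero factor
    \<open>q - inverse q\<close>, turning them into polynomial identities.\<close>
  have "(q - inverse q) * (qexp_a h X q c s + qexp_b h X q c s + c - X s) = 0"
    using ab by algebra
  moreover have "(q - inverse q) *
      (qexp_a h X q c s * q + qexp_b h X q c s * inverse q + c - X (s + h)) = 0"
    using ab qi by algebra
  ultimately show "X (s + of_int k * h) =
      qexp_a h X q c s * q powi k + qexp_b h X q c s * q powi (- k) + c"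
    using three_term_relation_closed_form[OF assms(1,2) s rec, of k] \<open>q - inverse q \<noteq> 0\<close>
    by (simp add: power_int_minus)
qed (use assms(3) ex_q_parameter in blast)+

lemma admissible_three_cases:
  assumes "half_step_invariant h U" "admissible h U X"
  obtains A B where "three_term_relation h U X A B"
    "quadratic_case h U X A B \<or> alternating_case h U X A B \<or> q_exponential_case h U X A B"
proof -
  obtain \<alpha> \<beta> where half: "\<And>s. s \<in> U \<Longrightarrow> X (s + h / 2) + X (s - h / 2) = \<alpha> * X s + \<beta>"
    using admissible_half_step_relation[OF assms(2)] by blast
  define A B where "A = \<alpha>\<^sup>2 - 2" and "B = (\<alpha> + 2) * \<beta>"
  have rel: "three_term_relation h U X A B"
    unfolding A_def B_def using assms(1) half by (rule three_term_relation_if_half_step_relation)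
  consider "A = 2" | "A = -2" | "A\<^sup>2 \<noteq> 4"
    using power2_eq_iff[of A 2] by auto
  then have "quadratic_case h U X A B \<or> alternating_case h U X A B \<or> q_exponential_case h U X A B"
  proof cases
    case 1
    then show ?thesis using rel quadratic_caseI[OF assms(1)] by simp
  next
    case 2
    then have "\<alpha> = 0" by (simp add: A_def)
    have "X (s + h) + X s = B / 2" if "s \<in> U" for s
    proof -
      \<comment> \<open>With \<alpha> = 0 the half-step relation centred here reads X(s + h) + X(s)
        = \<beta>, and \<open>B\<close> is 2 \<beta>.\<close>
      have "s + h / 2 \<in> U"
        using assms(1) that by (simp add: half_step_invariant_def)
      then show ?thesis
        using half[of "s + h / 2"] by (simp add: \<open>\<alpha> = 0\<close> B_def two_half_steps)
    qed
    then show ?thesis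
      using 2 rel alternating_caseI[OF assms(1)] by simp
  next
    case 3
    then show ?thesis using rel q_exponential_caseI[OF assms(1)] by simp
  qed
  then show thesis using that rel by blast
qed

section \<open>Admissible maps with varying coefficients\<close>

text \<open>The factorisation of u^n - v^n is applied to each monomial of \<open>p\<close>. With
  \<open>f\<close> and \<open>g\<close> of degree at most 1, the cofactor of u - v has degree at
  most n - 1.\<close>

lemma poly_divided_difference:
  fixes f g p :: "'a::idom poly"
  assumes "degree f \<le> 1" "degree g \<le> 1"
  obtains Q where "degree Q \<le> degree p - 1"
    "\<And>x. poly p (poly f x) - poly p (poly g x) = (poly f x - poly g x) * poly Q x"
proof
  \<comment> \<open>For constant \<open>p\<close> the inner sum is empty, so \<open>Q\<close> is 0
    and the truncated bound \<open>degree p - 1\<close> still holds.\<close>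
  define Q where "Q = (\<Sum>n\<le>degree p. smult (coeff p n) (\<Sum>i<n. g ^ (n - Suc i) * f ^ i))"
  have "degree (g ^ (n - Suc i) * f ^ i) \<le> degree p - 1" if "n \<le> degree p" "i < n" for n i
  proof -
    have "degree (g ^ (n - Suc i)) \<le> 1 * (n - Suc i)" "degree (f ^ i) \<le> 1 * i"
      using assms by (meson degree_power_le le_trans mult_le_mono1)+
    then show ?thesis
      using degree_mult_le[of "g ^ (n - Suc i)" "f ^ i"] that by linarith
  qed
  then show "degree Q \<le> degree p - 1"
    unfolding Q_def
    by (intro degree_sum_le) (auto intro!: degree_sum_le order_trans[OF degree_smult_le])
  show "poly p (poly f x) - poly p (poly g x) = (poly f x - poly g x) * poly Q x" for x
    unfolding Q_def
    by (subst (1 2) poly_altdef)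
       (simp add: sum_subtractf[symmetric] right_diff_distrib[symmetric] power_diff_sumr2
          poly_sum sum_distrib_left mult_ac)
qed

text \<open>The disjunction may be resolved differently at different \<open>s\<close>: exchanging Y
  and Z preserves the divided difference, so one \<open>Q\<close> serves all of
  \<open>U\<close>.\<close>

lemma admissible_if_linear_shifts:
  assumes "degree f \<le> 1" "degree g \<le> 1"
    and shifts: "\<And>s. s \<in> U \<Longrightarrow> X (s + h / 2) = poly f (X s) \<and> X (s - h / 2) = poly g (X s) \<or>
        X (s + h / 2) = poly g (X s) \<and> X (s - h / 2) = poly f (X s)"
    and neq: "\<And>s. s \<in> U \<Longrightarrow> poly f (X s) \<noteq> poly g (X s)"
    and "infinite (X ` U)"
  shows "admissible h U X"
  unfolding admissible_def
proof (intro conjI allI impI)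
  show "parametrising_map h U X"
    unfolding parametrising_map_def using shifts neq by force
next
  fix p :: "complex poly"
  obtain Q where Q: "degree Q \<le> degree p - 1"
    "\<And>x. poly p (poly f x) - poly p (poly g x) = (poly f x - poly g x) * poly Q x"
    using poly_divided_difference[OF assms(1,2)] by blast
  have "(poly p (X (s + h / 2)) - poly p (X (s - h / 2))) / (X (s + h / 2) - X (s - h / 2)) =
      poly Q (X s)" if "s \<in> U" for s
  proof -
    have "poly p (poly g (X s)) - poly p (poly f (X s)) =
        (poly g (X s) - poly f (X s)) * poly Q (X s)"
      using Q(2)[of "X s"] by algebra
    then show ?thesis
      using shifts[OF that] neq[OF that] Q(2)[of "X s"] by auto
  qed
  with Q(1) show "\<exists>Q. degree Q \<le> degree p - 1 \<and> (\<forall>s\<in>U.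
      (poly p (X (s + h / 2)) - poly p (X (s - h / 2))) / (X (s + h / 2) - X (s - h / 2)) =
      poly Q (X s))"
    by blast
qed (fact assms(5))

section \<open>Disjoint progressions and a sign on half-step cosets\<close>

lemma half_step_invariant_UNIV: "half_step_invariant h UNIV"
  by (simp add: half_step_invariant_def)

lemma of_int_neq_imaginary_unit: "of_int k \<noteq> \<i>"
  by (simp add: complex_eq_iff)

text \<open>The points 0 and \<open>\<i> * h\<close> differ by a non-integer multiple of
  \<open>h\<close>, so their progressions are disjoint.\<close>

lemma varies_between_progressionsI:
  assumes "h \<noteq> 0" "f 0 \<noteq> f (\<i> * h)"
  shows "varies_between_progressions h UNIV f"
proof -
  have "progression h 0 \<inter> progression h (\<i> * h) = {}"
  proof (rule ccontr)
    assume "progression h 0 \<inter> progression h (\<i> * h) \<noteq> {}"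
    then obtain k l :: int where "of_int k * h = \<i> * h + of_int l * h"
      by (auto simp: progression_def)
    then have "of_int (k - l) * h = \<i> * h"
      by (simp add: algebra_simps)
    with assms(1) of_int_neq_imaginary_unit[of "k - l"] show False
      by simp
  qed
  with assms(2) show ?thesis
    by (auto simp: varies_between_progressions_def)
qed

text \<open>The condition says that \<open>s\<close> lies in the coset (h/2)\<int> of 0. The sign is
  thus constant under half steps, and it reverses direction on every other coset.\<close>

definition coset_sign :: "complex \<Rightarrow> complex \<Rightarrow> complex" where
  "coset_sign h s = (if 2 * s / h \<in> \<int> then 1 else -1)"

lemma coset_sign_half_step:
  assumes "h \<noteq> 0"
  shows "coset_sign h (s + h / 2) = coset_sign h s" "coset_sign h (s - h / 2) = coset_sign h s"
proof -
  have "2 * (s + h / 2) / h = 2 * s / h + 1" "2 * (s - h / 2) / h = 2 * s / h - 1"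
    using assms by (simp_all add: field_simps)
  then show "coset_sign h (s + h / 2) = coset_sign h s" "coset_sign h (s - h / 2) = coset_sign h s"
    by (simp_all add: coset_sign_def)
qed

lemma coset_sign_full_step:
  assumes "h \<noteq> 0"
  shows "coset_sign h (s + h) = coset_sign h s" "coset_sign h (s - h) = coset_sign h s"
  using coset_sign_half_step[OF assms, of s] coset_sign_half_step(1)[OF assms, of "s + h / 2"]
    coset_sign_half_step(2)[OF assms, of "s - h / 2"] by (simp_all add: two_half_steps)

lemma coset_sign_of_nat: "h \<noteq> 0 \<Longrightarrow> coset_sign h (of_nat n * h) = 1"
  by (simp add: coset_sign_def)

lemma coset_sign_imaginary: "h \<noteq> 0 \<Longrightarrow> coset_sign h (\<i> * h) = -1"
  by (auto simp: coset_sign_def complex_eq_iff elim!: Ints_cases)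

lemma coset_sign_cases: "coset_sign h s = 1 \<or> coset_sign h s = -1"
  by (simp add: coset_sign_def)

section \<open>Examples of the three types\<close>

text \<open>The identity map has the same slope \<open>h\<close> on every progression; the sign
  changes the slope to \<open>- h\<close> off the coset of 0, so \<open>quad_b\<close> varies along
  with \<open>quad_c\<close>.\<close>

lemma quadratic_coefficients_vary:
  fixes h :: complex
  assumes h: "h \<noteq> 0"
  defines "W \<equiv> (\<lambda>s. coset_sign h s * s)"
  shows "admissible h UNIV W" "three_term_relation h UNIV W 2 0"
    "varies_between_progressions h UNIV (quad_b h W 0)"
    "varies_between_progressions h UNIV (quad_c W)"
proof -
  have W_nat: "W (of_nat n * h) = of_nat n * h" for n
    using coset_sign_of_nat[OF h] by (simp add: W_def)
  show "admissible h UNIV W"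
  proof (rule admissible_if_linear_shifts[where f = "[:h / 2, 1:]" and g = "[:- h / 2, 1:]"])
    show "W (s + h / 2) = poly [:h / 2, 1:] (W s) \<and> W (s - h / 2) = poly [:- h / 2, 1:] (W s) \<or>
        W (s + h / 2) = poly [:- h / 2, 1:] (W s) \<and> W (s - h / 2) = poly [:h / 2, 1:] (W s)" for s
      using coset_sign_cases[of h s] by (auto simp: W_def coset_sign_half_step[OF h])
    have "inj (\<lambda>n. W (of_nat n * h))"
      using h by (auto simp: W_nat intro!: injI)
    then have "infinite (range (\<lambda>n. W (of_nat n * h)))"
      by (rule range_inj_infinite)
    then show "infinite (range W)"
      by (rule infinite_super[rotated]) auto
  qed (use h in auto)
  show "three_term_relation h UNIV W 2 0"
    by (simp add: three_term_relation_def W_def coset_sign_full_step[OF h] algebra_simps)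
  have 0: "coset_sign h 0 = 1"
    by (simp add: coset_sign_def)
  have "W (0 + h) = h" "W (\<i> * h + h) = - (\<i> * h + h)"
    unfolding W_def coset_sign_full_step[OF h] by (simp_all add: 0 coset_sign_imaginary[OF h])
  then have "quad_b h W 0 0 = h" "quad_b h W 0 (\<i> * h) = - h"
    by (simp_all add: quad_b_def W_def coset_sign_imaginary[OF h])
  then show "varies_between_progressions h UNIV (quad_b h W 0)"
    using h by (intro varies_between_progressionsI) simp_all
  show "varies_between_progressions h UNIV (quad_c W)"
    using h by (intro varies_between_progressionsI)
      (simp_all add: quad_c_def W_def coset_sign_imaginary)
qed

text \<open>A half step multiplies \<open>W\<close> by \<open>\<i>\<close> or \<open>- \<i>\<close>,
  hence a full step by -1. With B = 0 the coefficient \<open>alt_a\<close> is \<open>W\<close>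
  itself.\<close>

lemma alternating_coefficients_vary:
  fixes h :: complex
  assumes h: "h \<noteq> 0"
  defines "W \<equiv> (\<lambda>s. exp (\<i> * of_real pi * s / h))"
  shows "admissible h UNIV W" "three_term_relation h UNIV W (-2) 0"
    "varies_between_progressions h UNIV (alt_a W 0)"
proof -
  have half: "W (s + h / 2) = \<i> * W s" "W (s - h / 2) = - \<i> * W s" for s
  proof -
    have "\<i> * of_real pi * (s + h / 2) / h = of_real pi / 2 * \<i> + \<i> * of_real pi * s / h"
      "\<i> * of_real pi * (s - h / 2) / h = - (of_real pi / 2 * \<i>) + \<i> * of_real pi * s / h"
      using h by (simp_all add: field_simps)
    moreover have "exp (of_real pi / 2 * \<i>) = \<i>"
      using cis_pi_half by (simp add: cis_conv_exp mult.commute)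
    ultimately show "W (s + h / 2) = \<i> * W s" "W (s - h / 2) = - \<i> * W s"
      by (simp_all only: W_def exp_add exp_minus) simp_all
  qed
  \<comment> \<open>Half steps from one point yield only four values. Moving in the direction
    \<open>\<i> * h\<close> gives infinitely many, and also distinguishes the points 0 and
    \<open>\<i> * h\<close>.\<close>
  have W_im: "W (\<i> * of_real x * h) = of_real (exp (- pi * x))" for x
  proof -
    have "\<i> * of_real pi * (\<i> * of_real x * h) / h = of_real (- pi * x)"
      using h by (simp add: algebra_simps)
    then show ?thesis
      unfolding W_def by (simp only: exp_of_real)
  qed
  show "admissible h UNIV W"
  proof (rule admissible_if_linear_shifts[where f = "[:0, \<i>:]" and g = "[:0, - \<i>:]"])
    have "inj (\<lambda>n. W (\<i> * of_real (real n) * h))"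
      unfolding W_im by (auto intro!: injI)
    then have "infinite (range (\<lambda>n. W (\<i> * of_real (real n) * h)))"
      by (rule range_inj_infinite)
    then show "infinite (range W)"
      by (rule infinite_super[rotated]) auto
    show "poly [:0, \<i>:] (W s) \<noteq> poly [:0, - \<i>:] (W s)" for s
      by (simp add: W_def)
  qed (simp_all add: half)
  show "three_term_relation h UNIV W (-2) 0"
    unfolding three_term_relation_def
  proof
    show "W (s + h) + W (s - h) = -2 * W s + 0" for s
      using half(1)[of "s + h / 2"] half(2)[of "s - h / 2"] by (simp add: half two_half_steps)
  qed
  have "alt_a W 0 0 \<noteq> alt_a W 0 (\<i> * h)"
    using W_im[of 0] W_im[of 1] by (simp add: alt_a_def)
  then show "varies_between_progressions h UNIV (alt_a W 0)"
    by (rule varies_between_progressionsI[OF h])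
qed

text \<open>\<open>W\<close> is 4^(s/h) on the coset of 0 and 4^(-s/h) elsewhere, with A = 4 + 1/4.
  Without the sign, the coefficient of 4^(-k) would vanish on every progression.\<close>

lemma q_exponential_coefficients_vary:
  fixes h :: complex
  assumes h: "h \<noteq> 0"
  defines "W \<equiv> (\<lambda>s. exp (2 * of_real (ln 2) * (coset_sign h s * s) / h))"
  shows "admissible h UNIV W" "three_term_relation h UNIV W (17 / 4) 0"
    "varies_between_progressions h UNIV (qexp_a h W 4 0)"
    "varies_between_progressions h UNIV (qexp_b h W 4 0)"
proof -
  define E where "E t = exp (2 * of_real (ln 2) * t / h)" for t
  have W_E: "W s = E (coset_sign h s * s)" for s
    by (simp add: W_def E_def)
  have E: "E (t + h / 2) = 2 * E t" "E (t - h / 2) = E t / 2" for t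
  proof -
    have "2 * of_real (ln 2) * (t + h / 2) / h = 2 * of_real (ln 2) * t / h + of_real (ln 2)"
      "2 * of_real (ln 2) * (t - h / 2) / h = 2 * of_real (ln 2) * t / h - of_real (ln 2)"
      using h by (simp_all add: field_simps)
    moreover have "exp (of_real (ln 2)) = (2::complex)"
      by (simp add: exp_of_real)
    ultimately show "E (t + h / 2) = 2 * E t" "E (t - h / 2) = E t / 2"
      by (simp_all only: E_def exp_add exp_diff mult.commute)
  qed
  have half_pos: "W (s + h / 2) = 2 * W s" "W (s - h / 2) = W s / 2" if "coset_sign h s = 1" for s
    unfolding W_E coset_sign_half_step[OF h] that mult_1_left E by (rule refl)+
  have half_neg: "W (s + h / 2) = W s / 2" "W (s - h / 2) = 2 * W s" if "coset_sign h s = -1" for s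
  proof -
    have "-1 * (s + h / 2) = -1 * s - h / 2" "-1 * (s - h / 2) = -1 * s + h / 2"
      by simp_all
    then show "W (s + h / 2) = W s / 2" "W (s - h / 2) = 2 * W s"
      unfolding W_E coset_sign_half_step[OF h] that by (simp_all only: E)
  qed
  have full_pos: "W (s + h) = 4 * W s" "W (s - h) = W s / 4" if "coset_sign h s = 1" for s
    using half_pos(1)[of "s + h / 2"] half_pos(2)[of "s - h / 2"] half_pos[of s] that
    by (simp_all only: coset_sign_half_step[OF h] two_half_steps) simp_all
  have full_neg: "W (s + h) = W s / 4" "W (s - h) = 4 * W s" if "coset_sign h s = -1" for s
    using half_neg(1)[of "s + h / 2"] half_neg(2)[of "s - h / 2"] half_neg[of s] that
    by (simp_all only: coset_sign_half_step[OF h] two_half_steps) simp_all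
  have W_nat: "W (of_nat n * h) = of_real (exp (2 * ln 2 * real n))" for n
    using h coset_sign_of_nat[OF h] by (simp add: W_def exp_of_real[symmetric] mult.assoc)
  have nz: "W s \<noteq> 0" for s
    by (simp add: W_def)
  show "admissible h UNIV W"
  proof (rule admissible_if_linear_shifts[where f = "[:0, 2:]" and g = "[:0, 1 / 2:]"])
    have "inj (\<lambda>n. W (of_nat n * h))"
      unfolding W_nat by (auto intro!: injI)
    then have "infinite (range (\<lambda>n. W (of_nat n * h)))"
      by (rule range_inj_infinite)
    then show "infinite (range W)"
      by (rule infinite_super[rotated]) auto
    show "W (s + h / 2) = poly [:0, 2:] (W s) \<and> W (s - h / 2) = poly [:0, 1 / 2:] (W s) \<or>
        W (s + h / 2) = poly [:0, 1 / 2:] (W s) \<and> W (s - h / 2) = poly [:0, 2:] (W s)" for s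
      using coset_sign_cases[of h s] by (auto simp: half_pos half_neg)
  qed (simp_all add: nz)
  have "W (s + h) + W (s - h) = 17 / 4 * W s + 0" for s
    using coset_sign_cases[of h s] by (auto simp: full_pos full_neg)
  then show "three_term_relation h UNIV W (17 / 4) 0"
    unfolding three_term_relation_def by blast
  have "W (0 + h) = 4 * W 0" "W (\<i> * h + h) = W (\<i> * h) / 4"
    using coset_sign_of_nat[OF h, of 0] coset_sign_imaginary[OF h] full_pos(1)[of 0]
      full_neg(1)[of "\<i> * h"] by simp_all
  \<comment> \<open>From 0 the solution is a pure multiple of 4^k, from \<open>\<i> * h\<close> a
    pure multiple of 4^(-k); each coefficient therefore vanishes at exactly one of the two
    points.\<close>
  then have "qexp_a h W 4 0 0 = W 0" "qexp_a h W 4 0 (\<i> * h) = 0"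
    "qexp_b h W 4 0 0 = 0" "qexp_b h W 4 0 (\<i> * h) = W (\<i> * h)"
    by (simp_all add: qexp_a_def qexp_b_def field_simps)
  then show "varies_between_progressions h UNIV (qexp_a h W 4 0)"
    "varies_between_progressions h UNIV (qexp_b h W 4 0)"
    using nz by (auto intro!: varies_between_progressionsI[OF h])
qed

lemma coefficients_may_vary:
  assumes "h \<noteq> 0"
  shows "coefficients_may_vary h"
proof -
  have quadratic: "\<exists>V W B. half_step_invariant h V \<and> admissible h V W \<and>
      three_term_relation h V W 2 B \<and> varies_between_progressions h V (quad_b h W B) \<and>
      varies_between_progressions h V (quad_c W)"
    using half_step_invariant_UNIV quadratic_coefficients_vary[OF assms] by blast
  have alternating: "\<exists>V W B. half_step_invariant h V \<and> admissible h V W \<and>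
      three_term_relation h V W (-2) B \<and> varies_between_progressions h V (alt_a W B)"
    using half_step_invariant_UNIV alternating_coefficients_vary[OF assms] by blast
  have "q_parameter (17 / 4) 4" "(17 / 4)\<^sup>2 \<noteq> (4::complex)"
    by (simp_all add: q_parameter_def power2_eq_square)
  then have q_exponential: "\<exists>V W A B q. half_step_invariant h V \<and> admissible h V W \<and>
      three_term_relation h V W A B \<and> A\<^sup>2 \<noteq> 4 \<and> q_parameter A q \<and>
      varies_between_progressions h V (qexp_a h W q (B / (2 - A))) \<and>
      varies_between_progressions h V (qexp_b h W q (B / (2 - A)))"
    using half_step_invariant_UNIV q_exponential_coefficients_vary[OF assms]
    \<comment> \<open>Since B = 0, the constant \<open>B / (2 - A)\<close> simplifies to the 0 used
      in the example.\<close>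
    by (intro exI[of _ UNIV] exI[of _ "\<lambda>s. exp (2 * of_real (ln 2) * (coset_sign h s * s) / h)"]
        exI[of _ "17 / 4"] exI[of _ 0] exI[of _ 4]) simp
  show ?thesis
    unfolding coefficients_may_vary_def
    by (intro conjI quadratic alternating q_exponential)
qed

section \<open>Classification along progressions\<close>

theorem theorem5p1:
  fixes h :: complex and U :: "complex set" and X :: "complex \<Rightarrow> complex"
  assumes "h \<noteq> 0"
    and "half_step_invariant h U"
    and "admissible h U X"
  shows "(\<exists>A B.
      three_term_relation h U X A B \<and>
      (\<forall>s\<^sub>0. progression h s\<^sub>0 \<subseteq> U \<longrightarrow>
         second_order_recurrence A B (along h X s\<^sub>0) \<and>
         (\<forall>x. second_order_recurrence A B x \<and> x 0 = X s\<^sub>0 \<and> x 1 = X (s\<^sub>0 + h) \<longrightarrow>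
            x = along h X s\<^sub>0)) \<and>
      (quadratic_case h U X A B \<or> alternating_case h U X A B \<or> q_exponential_case h U X A B) \<and>
      \<not> (quadratic_case h U X A B \<and> alternating_case h U X A B) \<and>
      \<not> (quadratic_case h U X A B \<and> q_exponential_case h U X A B) \<and>
      \<not> (alternating_case h U X A B \<and> q_exponential_case h U X A B) \<and>
      (\<forall>s\<^sub>0. progression h s\<^sub>0 \<subseteq> U \<longrightarrow>
         quadratic_type (along h X s\<^sub>0) \<or> alternating_type (along h X s\<^sub>0) \<or>
         q_exponential_type (along h X s\<^sub>0))) \<and>
    coefficients_may_vary h"
proof -
  obtain A B where rel: "three_term_relation h U X A B"
    and cases: "quadratic_case h U X A B \<or> alternating_case h U X A B \<or>
      q_exponential_case h U X A B"
    using admissible_three_cases[OF assms(2,3)] by blast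
  \<comment> \<open>The closed forms are stated for base points in \<open>U\<close>; the index 0
    places the base point of a contained progression there.\<close>
  have base: "s \<in> U" if "progression h s \<subseteq> U" for s
  proof -
    have "s + of_int 0 * h \<in> progression h s"
      unfolding progression_def by blast
    then show ?thesis using that by auto
  qed
  have rec: "second_order_recurrence A B (along h X s)" if "progression h s \<subseteq> U" for s
    using three_term_relation_along[OF assms(2) rel base[OF that]] .
  have unique: "x = along h X s" if "progression h s \<subseteq> U"
    "second_order_recurrence A B x" "x 0 = X s" "x 1 = X (s + h)" for s x
    using second_order_recurrence_unique[OF that(2) rec[OF that(1)]] that(3,4)
    by (simp add: along_def)
  have types: "quadratic_type (along h X s) \<or> alternating_type (along h X s) \<or>
      q_exponential_type (along h X s)" if "progression h s \<subseteq> U" for s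
  proof -
    have s: "s \<in> U"
      using base that .
    from cases show ?thesis
    proof (elim disjE)
      assume "quadratic_case h U X A B"
      then have "quadratic_type (along h X s)"
        using s unfolding quadratic_case_def quadratic_type_def along_def by blast
      then show ?thesis by blast
    next
      assume "alternating_case h U X A B"
      then have "alternating_type (along h X s)"
        using s unfolding alternating_case_def alternating_type_def along_def by blast
      then show ?thesis by blast
    next
      assume "q_exponential_case h U X A B"
      \<comment> \<open>The formula holds for every admissible choice of \<open>q\<close>; the
        existence clause supplies one to instantiate it.\<close>
      then obtain q where q: "q_parameter A q"
        and closed_form: "\<And>k. along h X s k = qexp_a h X q (B / (2 - A)) s * q powi k +
          qexp_b h X q (B / (2 - A)) s * q powi (- k) + B / (2 - A)"
        using s unfolding q_exponential_case_def along_def by meson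
      have "q \<noteq> 0" "q \<noteq> 1" "q \<noteq> -1"
        using q by (simp_all add: q_parameter_def)
      with closed_form have "q_exponential_type (along h X s)"
        unfolding q_exponential_type_def by meson
      then show ?thesis by blast
    qed
  qed
  \<comment> \<open>The value of \<open>A\<close> alone separates the cases: 2, -2, or a number
    whose square is not 4.\<close>
  have exclusive: "\<not> (quadratic_case h U X A B \<and> alternating_case h U X A B)"
    "\<not> (quadratic_case h U X A B \<and> q_exponential_case h U X A B)"
    "\<not> (alternating_case h U X A B \<and> q_exponential_case h U X A B)"
    by (auto simp: quadratic_case_def alternating_case_def q_exponential_case_def)
  show ?thesis
    by (intro conjI exI[of _ A] exI[of _ B] allI impI; (elim conjE)?;
        fact rel cases rec unique types exclusive coefficients_may_vary[OF assms(1)])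
qed

end
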